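(* Let $\mathcal{P}\subset\mathbb{R}^n$ be a rational polytope and $\mathcal{K}\subset\mathbb{R}^n$ a convex set such that $\mathcal{P}\oplus\mathcal{K}$ is a free sum, and let $d=d(\mathcal{P})$. Then $$\operatorname{cone}(\mathcal{P}\oplus\mathcal{K})\cap\mathbb{Z}^{n+1} = \bigsqcup_{i=0}^{d-1}\ \bigsqcup_{x\in(\operatorname{lenv}\operatorname{cone}^i\mathcal{P})\cap\mathbb{Z}^{n+1}} (x+\operatorname{cone}_i\mathcal{K})\cap\mathbb{Z}^{n+1}$$ (disjoint unions). Therefore $$\sigma_{\operatorname{cone}(\mathcal{P}\oplus\mathcal{K})} = \sum_{i=0}^{d-1}\sigma_{\operatorname{lenv}\operatorname{cone}^i\mathcal{P}}\,\sigma_{\operatorname{cone}_i\mathcal{K}} = \sum_{i=0}^{d-1}\left(\sigma_{\operatorname{cone}^i\mathcal{P}}-\sigma_{\operatorname{cone}^{i+1}\mathcal{P}}\right)\sigma_{\operatorname{cone}_i\mathcal{K}}.$$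
   Context: For convex $\mathcal{J},\mathcal{K}\subset\mathbb{R}^n$, $\mathcal{J}\oplus\mathcal{K}:=\operatorname{conv}(\mathcal{J}\cup\mathcal{K})$; "$\mathcal{J}\oplus\mathcal{K}$ is a free sum" means there is $g\in\mathsf{SL}_n(\mathbb{Z})$ such that $g\mathcal{J}$ and $g\mathcal{K}$ each contain the origin and their linear spans are orthogonal coordinate subspaces. For convex $\mathcal{K}$, $\operatorname{cone}\mathcal{K}\subset\mathbb{R}^{n+1}$ is the set of nonnegative multiples of points $(a,1)$, $a\in\mathcal{K}$. $\sigma_S(\mathbf{z})=\sum_{m\in S\cap\mathbb{Z}^{n+1}}\mathbf{z}^m$. For a closed linear cone $\mathcal{C}\subset\mathbb{R}^{n+1}$ not containing $-e_{n+1}$, $\epsilon_{\mathcal{C}}(x)=x-\max\{\lambda: x-\lambda e_{n+1}\in\mathcal{C}\}e_{n+1}$ and $\operatorname{lenv}\mathcal{C}=\epsilon_{\mathcal{C}}(\mathcal{C})$. For a rational polytope $\mathcal{P}\ni 0$, $\mathcal{P}^\vee=\{\phi\in(\operatorname{lin}\mathcal{P})^*:\phi\le1\text{ on }\mathcal{P}\}$ and $d(\mathcal{P})$ is the denominator of $\mathcal{P}^\vee$, i.e. the smallest positive integer $d$ such that all vertices of $d\mathcal{P}^\vee$ lie in the dual lattice $\{\phi:\phi(a)\in\mathbb{Z}\ \forall a\in\operatorname{lin}\mathcal{P}\cap\mathbb{Z}^n\}$. For integers $i\ge0$: $\operatorname{cone}^i\mathcal{P}=\operatorname{cone}\mathcal{P}+\frac{i}{d(\mathcal{P})}e_{n+1}$,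 $\operatorname{lenv}\operatorname{cone}^i\mathcal{P}=\operatorname{lenv}\operatorname{cone}\mathcal{P}+\frac{i}{d(\mathcal{P})}e_{n+1}$, and $\operatorname{cone}_i\mathcal{K}=\operatorname{cone}\mathcal{K}-\frac{i}{d(\mathcal{P})}e_{n+1}$. *)

theory Defs
  imports
    "HOL-Analysis.Analysis"
    "HOL-Library.Function_Algebras"
    "HOL-Library.Groups_Big_Fun"
    "HOL-Library.Disjoint_Sets"
begin

text \<open>
  Euclidean space of dimension \<open>n\<close> is \<open>real ^ 'n\<close>, and \<open>(real ^ 'n) \<times> real\<close> is Euclidean space of
  dimension \<open>n + 1\<close>, with the last coordinate in the second component.
\<close>

definition last_unit :: "(real ^ 'n) \<times> real" where
  "last_unit = (0, 1)"

definition lattice_pt :: "(int ^ 'n) \<times> int \<Rightarrow> (real ^ 'n) \<times> real" where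
  "lattice_pt m = ((\<chi> i. of_int (fst m $ i)), of_int (snd m))"

definition int_lattice :: "((real ^ 'n) \<times> real) set" where
  "int_lattice = range lattice_pt"

definition rational_polytope :: "(real ^ 'n) set \<Rightarrow> bool" where
  "rational_polytope P \<longleftrightarrow>
     polytope P \<and> (\<forall>v. v extreme_point_of P \<longrightarrow> (\<forall>i. v $ i \<in> \<rat>))"


subsection \<open>Free sums\<close>

definition SL_int :: "(real ^ 'n ^ 'n) set" where
  "SL_int = {g. (\<forall>i j. g $ i $ j \<in> \<int>) \<and> det g = 1}"

definition coordinate_subspace :: "(real ^ 'n) set \<Rightarrow> bool" where
  "coordinate_subspace S \<longleftrightarrow> (\<exists>I. S = span ((\<lambda>i. axis i 1) ` I))"

definition hull_sum :: "(real ^ 'n) set \<Rightarrow> (real ^ 'n) set \<Rightarrow> (real ^ 'n) set" where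
  "hull_sum J K = convex hull (J \<union> K)"

text \<open>The two coordinate subspaces need not span the whole space.\<close>

definition is_free_sum :: "(real ^ 'n) set \<Rightarrow> (real ^ 'n) set \<Rightarrow> bool" where
  "is_free_sum J K \<longleftrightarrow> (\<exists>g \<in> SL_int.
     0 \<in> (*v) g ` J \<and> 0 \<in> (*v) g ` K \<and>
     coordinate_subspace (span ((*v) g ` J)) \<and>
     coordinate_subspace (span ((*v) g ` K)) \<and>
     (\<forall>x \<in> span ((*v) g ` J). \<forall>y \<in> span ((*v) g ` K). orthogonal x y))"


subsection \<open>Polar dual and denominator\<close>

text \<open>
  A functional on a subspace \<open>V\<close> is represented by its unique linear extension to the whole space
  that vanishes on the orthogonal complement of \<open>V\<close>. In finite dimension every linear functional is
  bounded, so this is a linear isomorphic copy of the full algebraic dual of \<open>V\<close>.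
\<close>

definition dual_of_subspace :: "(real ^ 'n) set \<Rightarrow> ((real ^ 'n) \<Rightarrow>\<^sub>L real) set" where
  "dual_of_subspace V = {\<phi>. \<forall>x \<in> orthogonal_comp V. blinfun_apply \<phi> x = 0}"

definition polar_dual :: "(real ^ 'n) set \<Rightarrow> ((real ^ 'n) \<Rightarrow>\<^sub>L real) set" where
  "polar_dual P = {\<phi> \<in> dual_of_subspace (span P). \<forall>x \<in> P. blinfun_apply \<phi> x \<le> 1}"

definition dual_lattice :: "(real ^ 'n) set \<Rightarrow> ((real ^ 'n) \<Rightarrow>\<^sub>L real) set" where
  "dual_lattice P = {\<phi> \<in> dual_of_subspace (span P).
     \<forall>a \<in> span P. (\<forall>i. a $ i \<in> \<int>) \<longrightarrow> blinfun_apply \<phi> a \<in> \<int>}"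

definition dual_denominator :: "(real ^ 'n) set \<Rightarrow> nat" where
  "dual_denominator P = (LEAST d. 0 < d \<and>
     (\<forall>\<phi>. \<phi> extreme_point_of ((\<lambda>\<psi>. real d *\<^sub>R \<psi>) ` polar_dual P) \<longrightarrow> \<phi> \<in> dual_lattice P))"


subsection \<open>Cones and lower envelopes\<close>

definition cone_over :: "(real ^ 'n) set \<Rightarrow> ((real ^ 'n) \<times> real) set" where
  "cone_over K = {c *\<^sub>R (a, 1) | c a. 0 \<le> c \<and> a \<in> K}"

text \<open>The maximum exists when \<open>C\<close> is a closed cone not containing \<open>- last_unit\<close> and \<open>x \<in> C\<close>.\<close>

definition lower_proj ::
    "((real ^ 'n) \<times> real) set \<Rightarrow> (real ^ 'n) \<times> real \<Rightarrow> (real ^ 'n) \<times> real" where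
  "lower_proj C x = x - (GREATEST t. x - t *\<^sub>R last_unit \<in> C) *\<^sub>R last_unit"

definition lower_envelope ::
    "((real ^ 'n) \<times> real) set \<Rightarrow> ((real ^ 'n) \<times> real) set" where
  "lower_envelope C = lower_proj C ` C"

definition cone_up :: "nat \<Rightarrow> (real ^ 'n) set \<Rightarrow> ((real ^ 'n) \<times> real) set" where
  "cone_up i P =
     (\<lambda>x. x + (real i / real (dual_denominator P)) *\<^sub>R last_unit) ` cone_over P"

definition lenv_cone_up :: "nat \<Rightarrow> (real ^ 'n) set \<Rightarrow> ((real ^ 'n) \<times> real) set" where
  "lenv_cone_up i P =
     (\<lambda>x. x + (real i / real (dual_denominator P)) *\<^sub>R last_unit) ` lower_envelope (cone_over P)"

text \<open>The downward shift of the cone over \<open>K\<close> is measured by the denominator of \<open>P\<close>.\<close>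

definition cone_down ::
    "(real ^ 'n) set \<Rightarrow> nat \<Rightarrow> (real ^ 'n) set \<Rightarrow> ((real ^ 'n) \<times> real) set" where
  "cone_down P i K =
     (\<lambda>x. x - (real i / real (dual_denominator P)) *\<^sub>R last_unit) ` cone_over K"


subsection \<open>Lattice-point generating functions\<close>

text \<open>
  A formal Laurent series with integer coefficients, possibly infinite in all directions, is its
  coefficient function. Sums and differences are pointwise. The (Cauchy) product is meaningful only
  if every coefficient is a finite sum, which is what \<open>mult_defined\<close> states; the pointwise
  multiplication of functions is not the multiplication of series.
\<close>

type_synonym 'n laurent = "(int ^ 'n) \<times> int \<Rightarrow> int"

definition gen_fun :: "((real ^ 'n) \<times> real) set \<Rightarrow> 'n laurent" where
  "gen_fun S = (\<lambda>m. if lattice_pt m \<in> S then 1 else 0)"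

definition mult_defined :: "'n::finite laurent \<Rightarrow> 'n laurent \<Rightarrow> bool" where
  "mult_defined f g \<longleftrightarrow> (\<forall>m. finite {k. f k * g (m - k) \<noteq> 0})"

definition laurent_mult :: "'n::finite laurent \<Rightarrow> 'n laurent \<Rightarrow> 'n laurent" (infixl "\<star>" 70) where
  "f \<star> g = (\<lambda>m. Sum_any (\<lambda>k. f k * g (m - k)))"

end

theory Submission
  imports Defs
begin

text \<open>
  Let \<open>\<rho> v\<close> be the least height \<open>h\<close> with \<open>(v, h)\<close> in the cone over \<open>P\<close>. By duality for finitely
  generated cones, \<open>\<rho> v = \<phi> v\<close> for some vertex \<open>\<phi>\<close> of the polar dual, so \<open>d \<cdot> \<rho> v\<close> is an integer
  whenever \<open>v\<close> is a lattice point. The cone over a free sum is the sum of the cones over \<open>P\<close> and \<open>K\<close>,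
  and a lattice point \<open>(v + w, h)\<close> of it has lattice components \<open>v\<close> and \<open>w\<close>. Exactly one \<open>i < d\<close>
  makes \<open>\<rho> v + i / d\<close> an integer, and subtracting \<open>(v, \<rho> v + i / d)\<close> leaves a point of the cone
  over \<open>K\<close> shifted down by \<open>i / d\<close>.
\<close>

subsection \<open>Vertices of the polar dual\<close>

text \<open>Over the field of rationals, \<open>of_rat\<close> is an injective linear map into the
  vector space of reals, so it has a linear left inverse.\<close>

lemma exists_rational_retraction:
  obtains f :: "real \<Rightarrow> rat"
  where "\<And>x y. f (x + y) = f x + f y" "\<And>q x. f (of_rat q * x) = q * f x" "\<And>q. f (of_rat q) = q"
proof -
  interpret vs: vector_space_pair "(*) :: rat \<Rightarrow> rat \<Rightarrow> rat" "\<lambda>q x. of_rat q * x :: real"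
    by unfold_locales (simp_all add: algebra_simps of_rat_add of_rat_mult)
  have "Vector_Spaces.linear (*) (\<lambda>q x. of_rat q * x :: real) (of_rat :: rat \<Rightarrow> real)"
    by unfold_locales (simp_all add: of_rat_add of_rat_mult)
  moreover have "inj (of_rat :: rat \<Rightarrow> real)"
    by (simp add: inj_def)
  ultimately obtain g :: "real \<Rightarrow> rat"
    where g: "Vector_Spaces.linear (\<lambda>q x. of_rat q * x :: real) (*) g" and gid: "g \<circ> of_rat = id"
    using vs.linear_injective_left_inverse by blast
  interpret g: Vector_Spaces.linear "\<lambda>q x. of_rat q * x :: real" "(*)" g
    by (rule g)
  show thesis
  proof
    show "g (of_rat q) = q" for q
      using gid by (metis comp_apply id_apply)
  qed (simp_all add: g.add g.scale)
qed

text \<open>A \<open>\<rat>\<close>-linear retraction of \<open>\<real>\<close> onto \<open>\<rat>\<close>, applied to the coordinates of a real solution,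
  gives a rational one.\<close>
lemma rational_solution:
  fixes a :: "real ^ 'n"
  assumes rat: "\<And>v i. v \<in> T \<Longrightarrow> v $ i \<in> \<rat>" and sol: "\<And>v. v \<in> T \<Longrightarrow> a \<bullet> v = 1"
  obtains q :: "real ^ 'n" where "\<And>i. q $ i \<in> \<rat>" "\<And>v. v \<in> T \<Longrightarrow> q \<bullet> v = 1"
proof -
  obtain f :: "real \<Rightarrow> rat" where f: "\<And>x y. f (x + y) = f x + f y"
    "\<And>q x. f (of_rat q * x) = q * f x" "\<And>q. f (of_rat q) = q"
    using exists_rational_retraction by blast
  have f0: "f 0 = 0" and f1: "f 1 = 1"
    using f(3)[of 0] f(3)[of 1] by simp_all
  have fsum: "f (sum g A) = (\<Sum>i\<in>A. f (g i))" for g :: "'n \<Rightarrow> real" and A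
    by (induction A rule: infinite_finite_induct) (simp_all add: f0 f(1))
  \<comment> \<open>\<open>f\<close> is linear only over the rationals, so it splits a product when
    one factor is rational; below that factor is a coordinate of a point of
    \<open>T\<close>.\<close>
  have fmul: "f (x * y) = f x * f y" if "y \<in> \<rat>" for x y
    using that f(2)[of _ x] f(3) by (auto elim!: Rats_cases simp: mult.commute)
  show thesis
  proof
    let ?q = "(\<chi> i. of_rat (f (a $ i))) :: real ^ 'n"
    show "?q $ i \<in> \<rat>" for i
      by simp
    show "?q \<bullet> v = 1" if v: "v \<in> T" for v
    proof -
      have "of_rat (f (v $ i)) = v $ i" for i
        using rat[OF v, of i] f(3) by (auto elim!: Rats_cases)
      then have "?q \<bullet> v = of_rat (\<Sum>i\<in>UNIV. f (a $ i) * f (v $ i))"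
        by (simp add: inner_vec_def of_rat_sum of_rat_mult)
      also have "\<dots> = of_rat (f (a \<bullet> v))"
        by (simp add: inner_vec_def fsum fmul rat[OF v])
      finally show ?thesis
        by (simp add: sol[OF v] f1)
    qed
  qed
qed

lemma common_denominator:
  fixes q :: "'a \<Rightarrow> real"
  assumes "finite A" "\<And>i. i \<in> A \<Longrightarrow> q i \<in> \<rat>"
  obtains D :: nat where "D > 0" "\<And>i. i \<in> A \<Longrightarrow> real D * q i \<in> \<int>"
proof -
  have "\<exists>D::nat. D > 0 \<and> (\<forall>i\<in>A. real D * q i \<in> \<int>)"
    using assms
  proof (induction A)
    case (insert x A)
    obtain D :: nat where D: "D > 0" "\<forall>i\<in>A. real D * q i \<in> \<int>"
      using insert by auto
    obtain a b where ab: "b > 0" "q x = of_int a / of_int b"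
      using insert.prems[of x] by (metis insertI1 Rats_cases')
    have "real (D * nat b) * q i \<in> \<int>" if "i \<in> insert x A" for i
    proof (cases "i = x")
      case True
      then have "real (D * nat b) * q i = of_int (int D * a)"
        using ab by simp
      then show ?thesis
        by (metis Ints_of_int)
    next
      case False
      have "real (D * nat b) * q i = real (nat b) * (real D * q i)"
        by simp
      then show ?thesis
        using D False that by (metis Ints_mult Ints_of_nat insertE)
    qed
    then show ?case
      using D ab by (intro exI[of _ "D * nat b"]) auto
  qed auto
  then show thesis
    using that by blast
qed

lemma inner_Ints:
  fixes x y :: "real ^ 'n"
  assumes "\<And>i. x $ i \<in> \<int>" "\<And>i. y $ i \<in> \<int>"
  shows "x \<bullet> y \<in> \<int>"
  using assms by (auto simp: inner_vec_def intro!: Ints_sum Ints_mult)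

section \<open>Functionals on a subspace and tight constraints of the polar dual\<close>

text \<open>Both functionals vanish on the orthogonal complement, which together with
  \<open>V\<close> fills the whole space.\<close>

lemma dual_eqI:
  assumes "\<phi> \<in> dual_of_subspace V" "\<psi> \<in> dual_of_subspace V" "subspace V"
    and "\<And>x. x \<in> V \<Longrightarrow> blinfun_apply \<phi> x = blinfun_apply \<psi> x"
  shows "\<phi> = \<psi>"
proof (rule blinfun_eqI)
  fix x
  have "x \<in> V + V\<^sup>\<bottom>"
    using subspace_sum_orthogonal_comp[OF assms(3)] by simp
  then obtain y z where "x = y + z" "y \<in> V" "z \<in> V\<^sup>\<bottom>"
    by (auto elim: set_plus_elim)
  then show "blinfun_apply \<phi> x = blinfun_apply \<psi> x"
    using assms by (simp add: blinfun.add_right dual_of_subspace_def)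
qed

lemma inner_in_dual: "a \<in> V \<Longrightarrow> blinfun_inner_right a \<in> dual_of_subspace V"
  by (simp add: dual_of_subspace_def orthogonal_comp_def orthogonal_def)

lemma blinfun_as_inner:
  fixes \<phi> :: "'a::euclidean_space \<Rightarrow>\<^sub>L real"
  obtains a where "\<And>x. blinfun_apply \<phi> x = a \<bullet> x"
proof
  fix x
  \<comment> \<open>The representing vector is the value of the adjoint at \<open>1\<close>.\<close>
  show "blinfun_apply \<phi> x = adjoint (blinfun_apply \<phi>) 1 \<bullet> x"
    using adjoint_works[of "blinfun_apply \<phi>" x 1]
    by (simp add: bounded_linear.linear blinfun.bounded_linear_right inner_commute)
qed

lemma subspace_dual: "subspace (dual_of_subspace V)"
  by (auto simp: subspace_def dual_of_subspace_def blinfun.add_left blinfun.scaleR_left)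

lemma span_convex_hull: "span (convex hull S) = span S"
  by (meson convex_hull_subset_span hull_subset span_eq order_trans span_superset)

text \<open>A half-space is convex, so a bound on the generators extends to their hull. For a
  polytope this leaves finitely many constraints.\<close>

lemma polar_dual_convex_hull:
  "\<phi> \<in> polar_dual (convex hull F) \<longleftrightarrow>
    \<phi> \<in> dual_of_subspace (span F) \<and> (\<forall>v\<in>F. blinfun_apply \<phi> v \<le> 1)"
proof -
  have "convex {x. blinfun_apply \<phi> x \<le> 1}"
    by (intro convexI)
      (simp add: blinfun.add_right blinfun.scaleR_right convex_bound_le)
  then have "convex hull F \<subseteq> {x. blinfun_apply \<phi> x \<le> 1}" if "\<forall>v\<in>F. blinfun_apply \<phi> v \<le> 1"
    using that by (intro hull_minimal) auto
  then show ?thesis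
    using hull_subset[of F convex] by (auto simp: polar_dual_def span_convex_hull)
qed

text \<open>Supplies the step length for perturbing a functional: \<open>g\<close> is the slack at
  the points that are not tight, \<open>h\<close> the size of the perturbation.\<close>

lemma small_multiple_exists:
  fixes g h :: "'a \<Rightarrow> real"
  assumes "finite A" "\<And>v. v \<in> A \<Longrightarrow> g v > 0"
  obtains e where "e > 0" "\<And>v. v \<in> A \<Longrightarrow> e * h v \<le> g v"
proof -
  have "\<exists>e>0. \<forall>v\<in>A. e * h v \<le> g v"
    using assms
  proof (induction A)
    case empty
    show ?case
      by (auto intro: exI[of _ 1])
  next
    case (insert x A)
    obtain e where e: "e > 0" "\<forall>v\<in>A. e * h v \<le> g v"
      using insert by auto
    \<comment> \<open>The summand \<open>1\<close> keeps the denominator positive when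
      \<open>h x = 0\<close>.\<close>
    define e' where "e' = min e (g x / (1 + \<bar>h x\<bar>))"
    have "g x > 0"
      using insert.prems by simp
    then have "e' > 0"
      using e by (simp add: e'_def add_pos_nonneg)
    have "e' * h x \<le> e' * (1 + \<bar>h x\<bar>)"
      using \<open>e' > 0\<close> by (intro mult_left_mono) auto
    also have "\<dots> \<le> g x / (1 + \<bar>h x\<bar>) * (1 + \<bar>h x\<bar>)"
      by (intro mult_right_mono) (auto simp: e'_def)
    also have "\<dots> = g x"
      by (simp add: add_pos_nonneg)
    finally have "e' * h x \<le> g x" .
    moreover have "e' * h v \<le> g v" if "v \<in> A" for v
    proof (cases "h v \<ge> 0")
      case True
      then have "e' * h v \<le> e * h v"
        by (intro mult_right_mono) (auto simp: e'_def)
      then show ?thesis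
        using e that by fastforce
    next
      case False
      then have "e' * h v \<le> 0"
        using \<open>e' > 0\<close> by (simp add: mult_nonneg_nonpos)
      also have "0 \<le> g v"
        using insert.prems that by (simp add: less_imp_le)
      finally show ?thesis .
    qed
    ultimately show ?case
      using \<open>e' > 0\<close> by auto
  qed
  then show thesis
    using that by blast
qed

text \<open>If the tight points do not span, a direction orthogonal to all of them moves
  \<open>\<phi>\<close> both ways inside the polar dual. Conversely, the endpoints of a segment
  through \<open>\<phi>\<close> are tight wherever \<open>\<phi>\<close> is, so they agree on a
  spanning set.\<close>

lemma extreme_point_of_polar_dual:
  assumes "finite F" "\<phi> \<in> polar_dual (convex hull F)"
  shows "\<phi> extreme_point_of polar_dual (convex hull F) \<longleftrightarrow>
    span {v\<in>F. blinfun_apply \<phi> v = 1} = span F"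
proof
  let ?T = "{v\<in>F. blinfun_apply \<phi> v = 1}"
  assume ex: "\<phi> extreme_point_of polar_dual (convex hull F)"
  show "span ?T = span F"
  proof (rule ccontr)
    assume "span ?T \<noteq> span F"
    then have "span ?T \<subset> span F"
      by (metis (no_types, lifting) mem_Collect_eq psubsetI span_mono subsetI)
    then obtain x where x: "x \<noteq> 0" "x \<in> span F" "\<And>y. y \<in> span ?T \<Longrightarrow> orthogonal x y"
      using orthogonal_to_subspace_exists_gen by blast
    \<comment> \<open>At points that are not tight, \<open>e\<close> keeps the perturbation within
      the slack of \<open>\<phi>\<close>; at tight points it vanishes by orthogonality.\<close>
    obtain e where e: "e > 0" "\<And>v. v \<in> F - ?T \<Longrightarrow> e * \<bar>x \<bullet> v\<bar> \<le> 1 - blinfun_apply \<phi> v"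
      using assms by (rule_tac small_multiple_exists[of "F - ?T" "\<lambda>v. 1 - blinfun_apply \<phi> v" "\<lambda>v. \<bar>x \<bullet> v\<bar>"])
        (force simp: polar_dual_convex_hull)+
    define \<psi> where "\<psi> = e *\<^sub>R blinfun_inner_right x"
    have \<psi>V: "\<psi> \<in> dual_of_subspace (span F)"
      unfolding \<psi>_def by (intro subspace_scale subspace_dual inner_in_dual x)
    have bound: "\<bar>blinfun_apply \<psi> v\<bar> \<le> 1 - blinfun_apply \<phi> v" if "v \<in> F" for v
    proof (cases "v \<in> ?T")
      case True
      then have "x \<bullet> v = 0"
        using x(3)[OF span_base[OF True]] by (simp add: orthogonal_def)
      then show ?thesis
        using True by (simp add: \<psi>_def blinfun.scaleR_left)
    next
      case False
      then show ?thesis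
        using e that by (simp add: \<psi>_def blinfun.scaleR_left abs_mult)
    qed
    have "\<phi> + \<psi> \<in> polar_dual (convex hull F)" "\<phi> - \<psi> \<in> polar_dual (convex hull F)"
      using assms(2) bound \<psi>V subspace_dual[of "span F"]
      by (force simp: polar_dual_convex_hull blinfun.add_left blinfun.diff_left
          intro: subspace_add subspace_diff)+
    moreover have "\<psi> \<noteq> 0"
    proof
      assume "\<psi> = 0"
      then have "blinfun_apply \<psi> x = 0"
        by simp
      then show False
        using x e by (simp add: \<psi>_def blinfun.scaleR_left)
    qed
    moreover have "\<phi> = (1 - 1/2) *\<^sub>R (\<phi> - \<psi>) + (1/2) *\<^sub>R (\<phi> + \<psi>)"
      by (simp add: algebra_simps flip: scaleR_add_left)
    moreover have "\<phi> - \<psi> \<noteq> \<phi> + \<psi>"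
    proof
      assume "\<phi> - \<psi> = \<phi> + \<psi>"
      moreover have "2 *\<^sub>R \<psi> = (\<phi> + \<psi>) - (\<phi> - \<psi>)"
        by (simp add: scaleR_2)
      ultimately have "2 *\<^sub>R \<psi> = 0"
        by (metis diff_self)
      with \<open>\<psi> \<noteq> 0\<close> show False
        by simp
    qed
    ultimately have "\<phi> \<in> open_segment (\<phi> - \<psi>) (\<phi> + \<psi>)"
      unfolding in_segment by (intro conjI exI[of _ "1/2"]) auto
    then show False
      using ex \<open>\<phi> + \<psi> \<in> _\<close> \<open>\<phi> - \<psi> \<in> _\<close> by (auto simp: extreme_point_of_def)
  qed
next
  let ?T = "{v\<in>F. blinfun_apply \<phi> v = 1}"
  assume sp: "span ?T = span F"
  show "\<phi> extreme_point_of polar_dual (convex hull F)"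
    unfolding extreme_point_of_def
  proof (intro conjI ballI notI)
    fix a b
    assume ab: "a \<in> polar_dual (convex hull F)" "b \<in> polar_dual (convex hull F)"
      and seg: "\<phi> \<in> open_segment a b"
    then obtain u where u: "a \<noteq> b" "0 < u" "u < 1" "\<phi> = (1 - u) *\<^sub>R a + u *\<^sub>R b"
      by (auto simp: in_segment)
    have "blinfun_apply a v = blinfun_apply b v" if "v \<in> ?T" for v
    proof -
      have *: "blinfun_apply a v \<le> 1" "blinfun_apply b v \<le> 1"
        using ab that by (auto simp: polar_dual_convex_hull)
      have "blinfun_apply \<phi> v = (1 - u) * blinfun_apply a v + u * blinfun_apply b v"
        by (simp add: u(4) blinfun.add_left blinfun.scaleR_left)
      \<comment> \<open>A positively weighted sum of two nonnegative slacks is zero, so both slacks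
        are zero.\<close>
      then have "(1 - u) * (1 - blinfun_apply a v) + u * (1 - blinfun_apply b v) = 0"
        using that by (simp add: algebra_simps)
      moreover have "(1 - u) * (1 - blinfun_apply a v) \<ge> 0" "u * (1 - blinfun_apply b v) \<ge> 0"
        using * u by simp_all
      ultimately have "(1 - u) * (1 - blinfun_apply a v) = 0" "u * (1 - blinfun_apply b v) = 0"
        by linarith+
      then show ?thesis
        using u by simp
    qed
    then have "blinfun_apply a x = blinfun_apply b x" if "x \<in> span F" for x
      using that sp
      by (intro linear_eq_on[of "blinfun_apply a" "blinfun_apply b" x ?T])
        (simp_all add: bounded_linear.linear blinfun.bounded_linear_right)
    then have "a = b"
      using ab by (intro dual_eqI[of _ "span F"]) (auto simp: polar_dual_convex_hull)
    with u show False
      by simp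
  qed (rule assms)
qed

text \<open>Scaling is an injective linear map and so preserves faces. This turns the vertices of
  the dilated dual in \<open>dual_denominator_def\<close> into vertices of the dual itself.\<close>

lemma extreme_point_of_scaleR_image:
  fixes S :: "'a::real_vector set"
  assumes "c \<noteq> 0"
  shows "(c *\<^sub>R x) extreme_point_of ((*\<^sub>R) c ` S) \<longleftrightarrow> x extreme_point_of S"
proof -
  have "linear ((*\<^sub>R) c :: 'a \<Rightarrow> 'a)" "inj ((*\<^sub>R) c :: 'a \<Rightarrow> 'a)"
    using assms by (simp_all add: linear_scaleR inj_on_def)
  then show ?thesis
    using face_of_linear_image[of "(*\<^sub>R) c" "{x}" S] by (simp add: face_of_singleton)
qed

lemma polytope_eq_hull_extreme_points:
  fixes P :: "'a::euclidean_space set"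
  assumes "polytope P"
  shows "finite {v. v extreme_point_of P}" "P = convex hull {v. v extreme_point_of P}"
proof -
  show "finite {v. v extreme_point_of P}"
    using assms by (intro finite_polyhedron_extreme_points polytope_imp_polyhedron)
  obtain S where S: "finite S" "P = convex hull S"
    using assms by (auto simp: polytope_def)
  show "P = convex hull {v. v extreme_point_of P}"
    unfolding S(2) by (rule Krein_Milman_polytope[OF S(1)])
qed

section \<open>Existence of the denominator of the polar dual\<close>

text \<open>All functionals equal to 1 on \<open>T\<close> agree on \<open>span T\<close>, and one
  of them has a rational coefficient vector. A common denominator of that vector serves them all, so
  \<open>D\<close> depends on \<open>T\<close> alone.\<close>

lemma functional_denominator:
  fixes T :: "(real ^ 'n) set"
  assumes rat: "\<And>v i. v \<in> T \<Longrightarrow> v $ i \<in> \<rat>"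
  obtains D :: nat where "D > 0" "\<And>(\<phi> :: (real ^ 'n) \<Rightarrow>\<^sub>L real) x.
    (\<And>v. v \<in> T \<Longrightarrow> blinfun_apply \<phi> v = 1) \<Longrightarrow> x \<in> span T \<Longrightarrow> (\<And>i. x $ i \<in> \<int>) \<Longrightarrow>
    real D * blinfun_apply \<phi> x \<in> \<int>"
proof (cases "\<exists>\<phi> :: (real ^ 'n) \<Rightarrow>\<^sub>L real. \<forall>v\<in>T. blinfun_apply \<phi> v = 1")
  case True
  then obtain \<phi>0 :: "(real ^ 'n) \<Rightarrow>\<^sub>L real" where \<phi>0: "\<And>v. v \<in> T \<Longrightarrow> blinfun_apply \<phi>0 v = 1"
    by blast
  obtain a where a: "\<And>x. blinfun_apply \<phi>0 x = a \<bullet> x"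
    using blinfun_as_inner by blast
  obtain q where q: "\<And>i. q $ i \<in> \<rat>" "\<And>v. v \<in> T \<Longrightarrow> q \<bullet> v = 1"
    using rational_solution[of T a] rat \<phi>0 a by metis
  obtain D :: nat where D: "D > 0" "\<And>i. real D * q $ i \<in> \<int>"
    using common_denominator[of UNIV "\<lambda>i. q $ i"] q(1) by auto
  show thesis
  proof (rule that[OF D(1)])
    fix \<phi> :: "(real ^ 'n) \<Rightarrow>\<^sub>L real" and x
    assume *: "\<And>v. v \<in> T \<Longrightarrow> blinfun_apply \<phi> v = 1" "x \<in> span T" "\<And>i. x $ i \<in> \<int>"
    have "linear (blinfun_apply \<phi>)" "linear ((\<bullet>) q)"
      by (simp_all add: bounded_linear.linear blinfun.bounded_linear_right bounded_linear_inner_right)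
    then have "blinfun_apply \<phi> x = q \<bullet> x"
      using linear_eq_on[of "blinfun_apply \<phi>" "(\<bullet>) q" x T] * q(2) by simp
    then have "real D * blinfun_apply \<phi> x = (real D *\<^sub>R q) \<bullet> x"
      by simp
    then show "real D * blinfun_apply \<phi> x \<in> \<int>"
      using inner_Ints[of "real D *\<^sub>R q" x] D(2) *(3) by (simp only: vector_scaleR_component real_scaleR_def)
  qed
next
  case False
  \<comment> \<open>No functional satisfies the condition, so \<open>D = 1\<close> works
    vacuously.\<close>
  then show thesis
    using that[of 1] by (metis zero_less_one)
qed

text \<open>The tight points of a vertex span \<open>span P\<close> and form one of finitely many
  subsets of \<open>F\<close>; the product of the denominators of all subsets works for every
  vertex.\<close>

lemma extreme_polar_dual_denominator:
  fixes P :: "(real ^ 'n) set"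
  assumes "rational_polytope P"
  obtains d :: nat where "d > 0"
    "\<And>\<phi>. \<phi> extreme_point_of polar_dual P \<Longrightarrow> real d *\<^sub>R \<phi> \<in> dual_lattice P"
proof -
  define F where "F = {v. v extreme_point_of P}"
  have fin: "finite F" and P: "P = convex hull F"
    using polytope_eq_hull_extreme_points assms unfolding F_def rational_polytope_def by blast+
  have rat: "v $ i \<in> \<rat>" if "v \<in> F" for v i
    using assms that by (auto simp: F_def rational_polytope_def)
  have "\<forall>T\<in>Pow F. \<exists>D::nat. D > 0 \<and> (\<forall>(\<phi> :: (real ^ 'n) \<Rightarrow>\<^sub>L real) x.
      (\<forall>v\<in>T. blinfun_apply \<phi> v = 1) \<longrightarrow> x \<in> span T \<longrightarrow> (\<forall>i. x $ i \<in> \<int>) \<longrightarrow>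
      real D * blinfun_apply \<phi> x \<in> \<int>)"
  proof
    fix T assume "T \<in> Pow F"
    then have "\<And>v i. v \<in> T \<Longrightarrow> v $ i \<in> \<rat>"
      using rat by blast
    then obtain D :: nat where "D > 0" "\<And>(\<phi> :: (real ^ 'n) \<Rightarrow>\<^sub>L real) x.
      (\<And>v. v \<in> T \<Longrightarrow> blinfun_apply \<phi> v = 1) \<Longrightarrow> x \<in> span T \<Longrightarrow> (\<And>i. x $ i \<in> \<int>) \<Longrightarrow>
      real D * blinfun_apply \<phi> x \<in> \<int>"
      using functional_denominator[of T] by metis
    then show "\<exists>D::nat. D > 0 \<and> (\<forall>(\<phi> :: (real ^ 'n) \<Rightarrow>\<^sub>L real) x.
      (\<forall>v\<in>T. blinfun_apply \<phi> v = 1) \<longrightarrow> x \<in> span T \<longrightarrow> (\<forall>i. x $ i \<in> \<int>) \<longrightarrow>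
      real D * blinfun_apply \<phi> x \<in> \<int>)"
      by blast
  qed
  then obtain D :: "(real ^ 'n) set \<Rightarrow> nat" where D: "\<And>T. T \<in> Pow F \<Longrightarrow> D T > 0"
    "\<And>T (\<phi> :: (real ^ 'n) \<Rightarrow>\<^sub>L real) x. T \<in> Pow F \<Longrightarrow> (\<forall>v\<in>T. blinfun_apply \<phi> v = 1) \<Longrightarrow>
      x \<in> span T \<Longrightarrow> (\<forall>i. x $ i \<in> \<int>) \<Longrightarrow> real (D T) * blinfun_apply \<phi> x \<in> \<int>"
    by metis
  show thesis
  proof
    show "prod D (Pow F) > 0"
      using D(1) by (intro prod_pos) auto
    fix \<phi> assume ex: "\<phi> extreme_point_of polar_dual P"
    then have \<phi>: "\<phi> \<in> polar_dual (convex hull F)"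
      by (simp add: extreme_point_of_def P)
    define T where "T = {v\<in>F. blinfun_apply \<phi> v = 1}"
    have T: "T \<in> Pow F" "span T = span P"
      using ex extreme_point_of_polar_dual[OF fin \<phi>] by (auto simp: T_def P span_convex_hull)
    have dual: "real (prod D (Pow F)) *\<^sub>R \<phi> \<in> dual_of_subspace (span P)"
      using \<phi> by (intro subspace_scale[OF subspace_dual]) (simp add: P polar_dual_def)
    have "real (prod D (Pow F)) * blinfun_apply \<phi> x \<in> \<int>" if "x \<in> span P" "\<forall>i. x $ i \<in> \<int>" for x
    proof -
      \<comment> \<open>The factor \<open>D T\<close> of the tight set makes the value an integer;
        the remaining factors are integers.\<close>
      have "real (prod D (Pow F)) * blinfun_apply \<phi> x
          = real (prod D (Pow F - {T})) * (real (D T) * blinfun_apply \<phi> x)"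
        using fin T by (subst prod.remove[of _ T]) auto
      moreover have "real (D T) * blinfun_apply \<phi> x \<in> \<int>"
        using that T by (intro D(2)) (auto simp: T_def)
      ultimately show ?thesis
        by (metis Ints_mult Ints_of_nat)
    qed
    then show "real (prod D (Pow F)) *\<^sub>R \<phi> \<in> dual_lattice P"
      using dual by (simp add: dual_lattice_def blinfun.scaleR_left)
  qed
qed

text \<open>\<open>extreme_polar_dual_denominator\<close> provides an admissible number, so the
  minimum in the definition is attained and is itself admissible.\<close>

lemma dual_denominator:
  fixes P :: "(real ^ 'n) set"
  assumes "rational_polytope P"
  shows "0 < dual_denominator P"
    and "\<phi> extreme_point_of polar_dual P \<Longrightarrow> real (dual_denominator P) *\<^sub>R \<phi> \<in> dual_lattice P"
proof -
  define ok where "ok d \<longleftrightarrow> 0 < d \<and>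
     (\<forall>\<phi>. \<phi> extreme_point_of ((\<lambda>\<psi>. real d *\<^sub>R \<psi>) ` polar_dual P) \<longrightarrow> \<phi> \<in> dual_lattice P)" for d
  obtain d :: nat where d: "d > 0"
    "\<And>\<phi>. \<phi> extreme_point_of polar_dual P \<Longrightarrow> real d *\<^sub>R \<phi> \<in> dual_lattice P"
    using extreme_polar_dual_denominator[OF assms] by blast
  have "\<phi> \<in> dual_lattice P" if "\<phi> extreme_point_of ((\<lambda>\<psi>. real d *\<^sub>R \<psi>) ` polar_dual P)" for \<phi>
  proof -
    from that obtain \<psi> where "\<phi> = real d *\<^sub>R \<psi>"
      by (auto simp: extreme_point_of_def)
    with that d show ?thesis
      by (simp add: extreme_point_of_scaleR_image)
  qed
  with d have "ok d"
    by (simp add: ok_def)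
  then have ok: "ok (dual_denominator P)"
    unfolding dual_denominator_def ok_def[symmetric] by (rule LeastI)
  then show "0 < dual_denominator P"
    by (simp add: ok_def)
  with ok show "real (dual_denominator P) *\<^sub>R \<phi> \<in> dual_lattice P"
    if "\<phi> extreme_point_of polar_dual P"
    using that by (simp add: ok_def extreme_point_of_scaleR_image)
qed

subsection \<open>Lower envelopes\<close>

lemma mem_cone_over: "(v, h) \<in> cone_over K \<longleftrightarrow> 0 \<le> h \<and> (\<exists>a\<in>K. v = h *\<^sub>R a)"
  by (auto simp: cone_over_def)

text \<open>Makes the theory of finitely generated cones applicable. For empty \<open>S\<close> the
  two sides differ, since a convex cone hull contains the origin.\<close>

lemma cone_over_convex_hull:
  assumes "S \<noteq> {}"
  shows "cone_over (convex hull S) = convex_cone hull ((\<lambda>a. (a, 1)) ` S)"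
proof -
  have "convex hull ((\<lambda>a. (a, 1)) ` S) = convex hull (S \<times> {1})"
    by (rule arg_cong[of _ _ "(hull) convex"]) auto
  also have "\<dots> = (convex hull S) \<times> {1}"
    by (simp add: convex_hull_Times)
  finally have "convex hull ((\<lambda>a. (a, 1)) ` S) = (convex hull S) \<times> {1 :: real}" .
  then show ?thesis
    using assms by (subst convex_cone_hull_convex_hull_nonempty) (auto simp: cone_over_def)
qed

text \<open>A Farkas argument. As \<open>r\<close> is least, adjoining the generator
  \<open>(- v, - r)\<close> to the cone does not bring in \<open>(0, -1)\<close>. A hyperplane
  separating that point, normalised in the last coordinate, is a functional at most 1 on
  \<open>F\<close> and at least \<open>r\<close> at \<open>v\<close>.\<close>

lemma supporting_functional_at_lower_envelope:
  fixes F :: "(real ^ 'n) set"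
  assumes fin: "finite F" and mem: "(v, r) \<in> cone_over (convex hull F)"
    and least: "\<And>h. (v, h) \<in> cone_over (convex hull F) \<Longrightarrow> r \<le> h"
  obtains \<phi> where "\<phi> \<in> polar_dual (convex hull F)" "blinfun_apply \<phi> v = r"
proof -
  obtain p where p: "0 \<le> r" "p \<in> convex hull F" "v = r *\<^sub>R p"
    using mem by (auto simp: mem_cone_over)
  then have ne: "F \<noteq> {}"
    by auto
  let ?L = "(\<lambda>a. (a, 1)) ` F :: ((real ^ 'n) \<times> real) set"
  let ?T = "convex_cone hull ({(- v, - r)} \<union> ?L)"
  have cone: "convex_cone ?T"
    by (rule convex_cone_convex_cone_hull)
  have single: "\<exists>t\<ge>0. y = t *\<^sub>R w" if "y \<in> convex_cone hull {w}" for y w :: "(real ^ 'n) \<times> real"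
    using that by (subst (asm) convex_cone_hull_convex_hull_nonempty) auto
  \<comment> \<open>Membership would give, after scaling by \<open>1 / t\<close>, a point of the
    cone over \<open>v\<close> at height \<open>r - 1 / t\<close>, below \<open>r\<close>. The case
    \<open>t = 0\<close> would require a point of height -1.\<close>
  have "(0, -1) \<notin> ?T"
  proof
    assume "(0, -1) \<in> ?T"
    then obtain y c where y: "y \<in> convex_cone hull {(- v, - r)}"
      and c: "c \<in> convex_cone hull ?L" and yc: "(0, -1) = y + c"
      unfolding convex_cone_hull_Un by blast
    obtain t where t: "t \<ge> 0" "y = t *\<^sub>R (- v, - r)"
      using single[OF y] by blast
    have c_eq: "c = (t *\<^sub>R v, t * r - 1)"
      using yc t by (cases c) (auto simp: prod_eq_iff eq_neg_iff_add_eq_0 algebra_simps)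
    then have mem': "(t *\<^sub>R v, t * r - 1) \<in> cone_over (convex hull F)"
      using c ne by (simp add: cone_over_convex_hull)
    then have "t \<noteq> 0"
      by (auto simp: mem_cone_over)
    with t have "t > 0"
      by simp
    have "(1 / t) *\<^sub>R c \<in> convex_cone hull ?L"
      using \<open>t > 0\<close> by (intro convex_cone_hull_mul c) auto
    then have "(v, r - 1 / t) \<in> cone_over (convex hull F)"
      using \<open>t > 0\<close> ne by (simp add: c_eq cone_over_convex_hull right_diff_distrib)
    from least[OF this] \<open>t > 0\<close> show False
      by simp
  qed
  moreover have "closed ?T"
    using fin by (intro closed_convex_cone_hull) simp
  ultimately obtain A b where A: "A \<bullet> (0, -1) < b" "\<And>x. x \<in> ?T \<Longrightarrow> A \<bullet> x > b"
    using separating_hyperplane_closed_point[OF convex_convex_cone_hull] by metis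
  obtain a \<alpha> where A_def: "A = (a, \<alpha>)"
    by (cases A)
  have "b < 0"
    using A(2)[OF convex_cone_contains_0[OF cone]] by simp
  then have "\<alpha> > 0"
    using A(1) by (simp add: A_def)
  \<comment> \<open>On a negative value, scaling by the positive factor
    \<open>b / (A \<bullet> x)\<close> would reach \<open>b\<close> itself, which the strict
    separation forbids.\<close>
  have nonneg: "A \<bullet> x \<ge> 0" if "x \<in> ?T" for x
  proof (rule ccontr)
    assume neg: "\<not> A \<bullet> x \<ge> 0"
    then have "(b / (A \<bullet> x)) *\<^sub>R x \<in> ?T"
      using \<open>b < 0\<close> by (intro convex_cone_hull_mul that) (simp add: divide_nonpos_neg)
    from A(2)[OF this] neg show False
      by simp
  qed
  \<comment> \<open>Dividing by \<open>\<alpha>\<close> turns nonnegativity on \<open>(w, 1)\<close>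
    into the polar inequality at \<open>w\<close>.\<close>
  define a' where "a' = (- 1 / \<alpha>) *\<^sub>R a"
  have le1: "a' \<bullet> w \<le> 1" if "w \<in> F" for w
  proof -
    have "A \<bullet> (w, 1) \<ge> 0"
      using that by (intro nonneg hull_inc) auto
    then show ?thesis
      using \<open>\<alpha> > 0\<close> by (simp add: A_def a'_def field_simps)
  qed
  have "A \<bullet> (- v, - r) \<ge> 0"
    by (intro nonneg hull_inc) auto
  then have ge: "a' \<bullet> v \<ge> r"
    using \<open>\<alpha> > 0\<close> by (simp add: A_def a'_def field_simps)
  \<comment> \<open>Projecting to \<open>span F\<close> puts the functional into the dual of the
    span without changing its values there.\<close>
  obtain y z where yz: "y \<in> span F" "\<And>w. w \<in> span F \<Longrightarrow> orthogonal z w" "a' = y + z"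
    using orthogonal_subspace_decomp_exists by blast
  have eq: "y \<bullet> w = a' \<bullet> w" if "w \<in> span F" for w
    using yz(2)[OF that] by (simp add: yz(3) inner_add_left orthogonal_def)
  have polar: "blinfun_inner_right y \<in> polar_dual (convex hull F)"
    unfolding polar_dual_convex_hull using inner_in_dual[OF yz(1)] le1 by (auto simp: eq span_base)
  have "v \<in> span F"
    using p by (metis span_convex_hull span_base span_scale)
  moreover have "y \<bullet> p \<le> 1"
    using polar p by (auto simp: polar_dual_def)
  \<comment> \<open>The upper bound comes from \<open>v = r *\<^sub>R p\<close> and
    \<open>y \<bullet> p \<le> 1\<close>.\<close>
  ultimately have "y \<bullet> v = r"
    using ge p eq mult_left_mono[of "y \<bullet> p" 1 r] by force
  with polar show thesis
    using that[of "blinfun_inner_right y"] by simp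
qed

text \<open>Among the functionals of the polar dual with value \<open>r\<close> at \<open>v\<close>, one that is tight at the most
  points of \<open>F\<close> is extreme.\<close>
lemma extreme_functional_at_lower_envelope:
  fixes F :: "(real ^ 'n) set"
  assumes fin: "finite F" and mem: "(v, r) \<in> cone_over (convex hull F)"
    and least: "\<And>h. (v, h) \<in> cone_over (convex hull F) \<Longrightarrow> r \<le> h"
  obtains \<phi> where "\<phi> extreme_point_of polar_dual (convex hull F)" "blinfun_apply \<phi> v = r"
proof -
  let ?T = "\<lambda>\<phi>. {w\<in>F. blinfun_apply \<phi> w = 1}"
  let ?ok = "\<lambda>\<phi>. \<phi> \<in> polar_dual (convex hull F) \<and> blinfun_apply \<phi> v = r"
  obtain \<phi>0 where "?ok \<phi>0"
    using supporting_functional_at_lower_envelope[OF assms] by blast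
  moreover have "\<forall>\<phi>. ?ok \<phi> \<longrightarrow> card (?T \<phi>) < Suc (card F)"
    using fin by (auto simp: less_Suc_eq_le intro: card_mono)
  ultimately have "\<exists>\<phi>. ?ok \<phi> \<and> (\<forall>\<psi>. ?ok \<psi> \<longrightarrow> card (?T \<psi>) \<le> card (?T \<phi>))"
    by (rule ex_has_greatest_nat[of ?ok \<phi>0 "\<lambda>\<phi>. card (?T \<phi>)"])
  then obtain \<phi> where *: "?ok \<phi> \<and> (\<forall>\<psi>. ?ok \<psi> \<longrightarrow> card (?T \<psi>) \<le> card (?T \<phi>))" ..
  then have \<phi>: "\<phi> \<in> polar_dual (convex hull F)" "blinfun_apply \<phi> v = r"
    by simp_all
  have max: "\<And>\<psi>. ?ok \<psi> \<Longrightarrow> card (?T \<psi>) \<le> card (?T \<phi>)"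
    by (rule mp[OF spec[OF conjunct2[OF *]]])
  have le1: "blinfun_apply \<phi> w \<le> 1" if "w \<in> F" for w
    using \<phi>(1) that by (simp add: polar_dual_convex_hull)
  \<comment> \<open>For \<open>r \<noteq> 0\<close> the value at \<open>p\<close> is 1. An average
    of values at most 1 equals 1 only if all points of positive weight are tight.\<close>
  have v_span: "v \<in> span (?T \<phi>)"
  proof (cases "r = 0")
    case True
    then show ?thesis
      using mem by (auto simp: mem_cone_over span_zero)
  next
    case False
    obtain p where p: "0 \<le> r" "p \<in> convex hull F" "v = r *\<^sub>R p"
      using mem by (auto simp: mem_cone_over)
    have \<phi>p: "blinfun_apply \<phi> p = 1"
      using \<phi>(2) p(3) False by (simp add: blinfun.scaleR_right)
    obtain u where u: "\<And>w. w \<in> F \<Longrightarrow> 0 \<le> u w" "sum u F = 1" "(\<Sum>w\<in>F. u w *\<^sub>R w) = p"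
      using p(2) by (auto simp: convex_hull_finite[OF fin])
    have "(\<Sum>w\<in>F. u w * (1 - blinfun_apply \<phi> w)) = sum u F - blinfun_apply \<phi> (\<Sum>w\<in>F. u w *\<^sub>R w)"
      by (simp add: blinfun.sum_right blinfun.scaleR_right right_diff_distrib sum_subtractf)
    also have "\<dots> = 0"
      using u \<phi>p by simp
    finally have tight: "\<forall>w\<in>F. u w * (1 - blinfun_apply \<phi> w) = 0"
      using u(1) le1 by (subst (asm) sum_nonneg_eq_0_iff[OF fin]) auto
    have "u w *\<^sub>R w \<in> span (?T \<phi>)" if "w \<in> F" for w
    proof (cases "u w = 0")
      case False
      then have "w \<in> ?T \<phi>"
        using bspec[OF tight that] that by simp
      then show ?thesis
        by (intro span_scale span_base)
    qed (simp add: span_zero)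
    then have "p \<in> span (?T \<phi>)"
      unfolding u(3)[symmetric] by (intro span_sum)
    then show ?thesis
      by (simp add: p(3) span_scale)
  qed
  have "span (?T \<phi>) = span F"
  proof (rule ccontr)
    assume "span (?T \<phi>) \<noteq> span F"
    then have "span (?T \<phi>) \<subset> span F"
      by (metis (no_types, lifting) mem_Collect_eq psubsetI span_mono subsetI)
    then obtain x where x: "x \<noteq> 0" "x \<in> span F" "\<And>y. y \<in> span (?T \<phi>) \<Longrightarrow> orthogonal x y"
      using orthogonal_to_subspace_exists_gen by blast
    have "\<exists>w\<in>F. x \<bullet> w \<noteq> 0"
    proof (rule ccontr)
      assume "\<not> ?thesis"
      then have "orthogonal x x"
        by (intro orthogonal_to_span[OF x(2)]) (auto simp: orthogonal_def)
      with x(1) show False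
        by (simp add: orthogonal_def)
    qed
    then obtain w1 where w1: "w1 \<in> F" "x \<bullet> w1 \<noteq> 0"
      by blast
    \<comment> \<open>The sign is chosen so that moving along \<open>y\<close> increases at least
      one constraint.\<close>
    define y where "y = (if x \<bullet> w1 > 0 then x else - x)"
    have y: "y \<in> span F" "y \<bullet> w1 > 0" "\<And>w. w \<in> span (?T \<phi>) \<Longrightarrow> y \<bullet> w = 0"
      using x w1 by (auto simp: y_def span_neg orthogonal_def)
    \<comment> \<open>A ratio test: \<open>t\<close> is the largest step before some constraint that
      increases along \<open>y\<close> would exceed 1.\<close>
    define t where "t = Min ((\<lambda>w. (1 - blinfun_apply \<phi> w) / (y \<bullet> w)) ` {w\<in>F. y \<bullet> w > 0})"
    have "t \<in> (\<lambda>w. (1 - blinfun_apply \<phi> w) / (y \<bullet> w)) ` {w\<in>F. y \<bullet> w > 0}"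
      unfolding t_def using fin w1 y by (intro Min_in) auto
    then obtain w0 where w0: "w0 \<in> F" "y \<bullet> w0 > 0" "t = (1 - blinfun_apply \<phi> w0) / (y \<bullet> w0)"
      by auto
    have "t \<ge> 0"
      using w0 le1 by simp
    have t_le: "t \<le> (1 - blinfun_apply \<phi> w) / (y \<bullet> w)" if "w \<in> F" "y \<bullet> w > 0" for w
      unfolding t_def using fin that by (intro Min_le) auto
    define \<psi> where "\<psi> = \<phi> + t *\<^sub>R blinfun_inner_right y"
    have \<psi>_apply: "blinfun_apply \<psi> w = blinfun_apply \<phi> w + t * (y \<bullet> w)" for w
      by (simp add: \<psi>_def blinfun.add_left blinfun.scaleR_left)
    have "blinfun_apply \<psi> w \<le> 1" if "w \<in> F" for w
    proof (cases "y \<bullet> w > 0")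
      case True
      then show ?thesis
        using t_le[OF that True] by (simp add: \<psi>_apply field_simps)
    next
      case False
      then have "t * (y \<bullet> w) \<le> 0"
        using \<open>t \<ge> 0\<close> by (simp add: mult_nonneg_nonpos)
      then show ?thesis
        using le1[OF that] by (simp add: \<psi>_apply)
    qed
    moreover have "\<psi> \<in> dual_of_subspace (span F)"
      unfolding \<psi>_def using \<phi>(1) y(1)
      by (intro subspace_add subspace_scale subspace_dual inner_in_dual)
        (simp_all add: polar_dual_convex_hull)
    \<comment> \<open>\<open>y\<close> is orthogonal to the span of the tight points, which contains
      \<open>v\<close>.\<close>
    moreover have "blinfun_apply \<psi> v = r"
      using y(3)[OF v_span] \<phi>(2) by (simp add: \<psi>_apply)
    ultimately have "card (?T \<psi>) \<le> card (?T \<phi>)"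
      by (intro max) (simp add: polar_dual_convex_hull)
    \<comment> \<open>Old tight points stay tight and \<open>w0\<close> joins them, against
      maximality.\<close>
    moreover have "?T \<phi> \<subset> ?T \<psi>"
    proof
      show "?T \<phi> \<subseteq> ?T \<psi>"
        using y(3) by (auto simp: \<psi>_apply span_base)
      have "w0 \<in> ?T \<psi>"
        using w0 by (simp add: \<psi>_apply)
      moreover have "w0 \<notin> ?T \<phi>"
        using y(3)[of w0] w0 span_base[of w0 "?T \<phi>"] by auto
      ultimately show "?T \<phi> \<noteq> ?T \<psi>"
        by blast
    qed
    ultimately show False
      using psubset_card_mono[of "?T \<psi>" "?T \<phi>"] fin by simp
  qed
  with extreme_point_of_polar_dual[OF fin \<phi>(1)] \<phi>(2) show thesis
    using that by blast
qed

section \<open>Heights over a fixed point and the lower envelope\<close>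

text \<open>Since \<open>K\<close> contains the origin, the base point may shrink by the factor
  \<open>r / h\<close> as the height grows.\<close>

lemma cone_over_mono_height:
  assumes "convex K" "0 \<in> K" "(v, r) \<in> cone_over K" "r \<le> h"
  shows "(v, h) \<in> cone_over K"
proof (cases "h = 0")
  case True
  with assms show ?thesis
    by (auto simp: mem_cone_over)
next
  case False
  obtain a where a: "0 \<le> r" "a \<in> K" "v = r *\<^sub>R a"
    using assms(3) by (auto simp: mem_cone_over)
  have "(r / h) *\<^sub>R a + (1 - r / h) *\<^sub>R 0 \<in> K"
    using a assms False by (intro convexD) auto
  then show ?thesis
    using a assms(4) False by (auto simp: mem_cone_over intro!: bexI[of _ "(r / h) *\<^sub>R a"])
qed

text \<open>The cone is finitely generated, hence closed, and its heights are bounded below by 0, so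
  the infimum is attained.\<close>

lemma cone_over_least_height:
  fixes P :: "(real ^ 'n) set"
  assumes "polytope P" "(v, h) \<in> cone_over P"
  obtains r where "(v, r) \<in> cone_over P" "\<And>h. (v, h) \<in> cone_over P \<Longrightarrow> r \<le> h"
proof -
  obtain F where F: "finite F" "P = convex hull F"
    using assms(1) by (auto simp: polytope_def)
  have "F \<noteq> {}"
    using assms F by (auto simp: mem_cone_over)
  then have "closed (cone_over P)"
    using F by (simp add: cone_over_convex_hull closed_convex_cone_hull)
  then have "closed ((\<lambda>h. (v, h)) -` cone_over P)"
    by (intro closed_vimage continuous_intros)
  moreover have "bdd_below ((\<lambda>h. (v, h)) -` cone_over P)"
    by (intro bdd_belowI[of _ 0]) (auto simp: mem_cone_over)
  moreover have "(\<lambda>h. (v, h)) -` cone_over P \<noteq> {}"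
    using assms(2) by auto
  ultimately show thesis
    using that[of "Inf ((\<lambda>h. (v, h)) -` cone_over P)"]
    by (metis closed_contains_Inf cInf_lower vimageD vimageI2)
qed

text \<open>If \<open>s\<close> is the least height over \<open>w\<close>, the greatest descent from
  \<open>(w, h)\<close> is \<open>h - s\<close>, so the projection lands on
  \<open>(w, s)\<close>.\<close>

lemma mem_lower_envelope_cone_over:
  fixes P :: "(real ^ 'n) set"
  assumes "polytope P"
  shows "(v, r) \<in> lower_envelope (cone_over P) \<longleftrightarrow>
    (v, r) \<in> cone_over P \<and> (\<forall>h. (v, h) \<in> cone_over P \<longrightarrow> r \<le> h)"
proof -
  have proj: "lower_proj (cone_over P) (w, h) = (w, s)"
    if s: "(w, s) \<in> cone_over P" "\<And>t. (w, t) \<in> cone_over P \<Longrightarrow> s \<le> t" for w h s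
  proof -
    have "(GREATEST t. (w, h) - t *\<^sub>R last_unit \<in> cone_over P) = h - s"
    proof (rule Greatest_equality)
      show "(w, h) - (h - s) *\<^sub>R last_unit \<in> cone_over P"
        using s(1) by (simp add: last_unit_def)
      show "t \<le> h - s" if "(w, h) - t *\<^sub>R last_unit \<in> cone_over P" for t
        using s(2)[of "h - t"] that by (simp add: last_unit_def)
    qed
    then show ?thesis
      by (simp add: lower_proj_def last_unit_def)
  qed
  show ?thesis
  proof
    assume "(v, r) \<in> lower_envelope (cone_over P)"
    then obtain w h where wh: "(w, h) \<in> cone_over P" "(v, r) = lower_proj (cone_over P) (w, h)"
      by (auto simp: lower_envelope_def)
    obtain s where s: "(w, s) \<in> cone_over P" "\<And>t. (w, t) \<in> cone_over P \<Longrightarrow> s \<le> t"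
      using cone_over_least_height[OF assms wh(1)] by blast
    have "(v, r) = (w, s)"
      unfolding wh(2) by (rule proj[OF s])
    with s show "(v, r) \<in> cone_over P \<and> (\<forall>h. (v, h) \<in> cone_over P \<longrightarrow> r \<le> h)"
      by simp
  next
    assume *: "(v, r) \<in> cone_over P \<and> (\<forall>h. (v, h) \<in> cone_over P \<longrightarrow> r \<le> h)"
    then have "lower_proj (cone_over P) (v, r) = (v, r)"
      by (intro proj) auto
    with * show "(v, r) \<in> lower_envelope (cone_over P)"
      unfolding lower_envelope_def by (metis image_eqI)
  qed
qed

lemma cone_over_in_span: "(v, h) \<in> cone_over P \<Longrightarrow> v \<in> span P"
  by (auto simp: mem_cone_over intro: span_scale span_base)

text \<open>\<open>r\<close> is the value at \<open>v\<close> of a vertex of the polar dual, and the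
  multiple of that vertex by the denominator is integral on lattice points of
  \<open>span P\<close>.\<close>

lemma lower_envelope_height_denominator:
  fixes P :: "(real ^ 'n) set"
  assumes "rational_polytope P" "(v, r) \<in> lower_envelope (cone_over P)" "\<And>i. v $ i \<in> \<int>"
  shows "real (dual_denominator P) * r \<in> \<int>"
proof -
  have P: "polytope P"
    using assms(1) by (simp add: rational_polytope_def)
  then obtain F where F: "finite F" "P = convex hull F"
    by (auto simp: polytope_def)
  have *: "(v, r) \<in> cone_over P" "\<And>h. (v, h) \<in> cone_over P \<Longrightarrow> r \<le> h"
    using assms(2) by (auto simp: mem_lower_envelope_cone_over[OF P])
  obtain \<phi> where \<phi>: "\<phi> extreme_point_of polar_dual P" "blinfun_apply \<phi> v = r"
    using extreme_functional_at_lower_envelope[OF F(1), folded F(2), OF *] by blast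
  have "real (dual_denominator P) *\<^sub>R \<phi> \<in> dual_lattice P"
    using dual_denominator(2)[OF assms(1) \<phi>(1)] .
  then show ?thesis
    using \<phi>(2) assms(3) cone_over_in_span[OF *(1)]
    by (auto simp: dual_lattice_def blinfun.scaleR_left)
qed

subsection \<open>Lattice points and generating functions\<close>

lemma mem_int_lattice: "(v, h) \<in> int_lattice \<longleftrightarrow> (\<forall>i. v $ i \<in> \<int>) \<and> h \<in> \<int>"
proof
  assume *: "(\<forall>i. v $ i \<in> \<int>) \<and> h \<in> \<int>"
  then have "(v, h) = lattice_pt (\<chi> i. \<lfloor>v $ i\<rfloor>, \<lfloor>h\<rfloor>)"
    by (auto simp: lattice_pt_def vec_eq_iff of_int_floor_cancel[THEN iffD2])
  then show "(v, h) \<in> int_lattice"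
    by (auto simp: int_lattice_def)
qed (auto simp: int_lattice_def lattice_pt_def)

lemma lattice_pt_diff: "lattice_pt (m - k) = lattice_pt m - lattice_pt k"
  by (simp add: lattice_pt_def vec_eq_iff)

lemma inj_lattice_pt: "inj lattice_pt"
  by (auto simp: inj_def lattice_pt_def vec_eq_iff prod_eq_iff)

section \<open>Products, sums and differences of generating functions\<close>

text \<open>Disjointness of the translates leaves at most one way to split \<open>m\<close>, so each
  coefficient of the product is a sum with at most one nonzero term, equal to 1.\<close>

lemma gen_fun_mult:
  fixes S T :: "((real ^ 'n) \<times> real) set"
  assumes disj: "disjoint_family_on (\<lambda>x. ((+) x ` T) \<inter> int_lattice) (S \<inter> int_lattice)"
  shows "mult_defined (gen_fun S) (gen_fun T)"
    and "gen_fun S \<star> gen_fun T = gen_fun (\<Union>x\<in>S \<inter> int_lattice. ((+) x ` T) \<inter> int_lattice)"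
proof -
  let ?U = "\<Union>x\<in>S \<inter> int_lattice. ((+) x ` T) \<inter> int_lattice"
  let ?N = "\<lambda>m. {k. gen_fun S k * gen_fun T (m - k) \<noteq> 0}"
  have N: "k \<in> ?N m \<longleftrightarrow> lattice_pt k \<in> S \<and> lattice_pt m \<in> (+) (lattice_pt k) ` T" for k m
  proof -
    have "lattice_pt m - lattice_pt k \<in> T \<longleftrightarrow> lattice_pt m \<in> (+) (lattice_pt k) ` T"
      by (force simp: image_iff)
    then show ?thesis
      by (simp add: gen_fun_def lattice_pt_diff)
  qed
  have lat: "lattice_pt m \<in> int_lattice" for m
    by (simp add: int_lattice_def)
  have uniq: "k = l" if "k \<in> ?N m" "l \<in> ?N m" for k l m
  proof (rule ccontr)
    assume "k \<noteq> l"
    then have "lattice_pt k \<noteq> lattice_pt l"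
      by (simp add: inj_eq[OF inj_lattice_pt])
    then have "((+) (lattice_pt k) ` T \<inter> int_lattice) \<inter> ((+) (lattice_pt l) ` T \<inter> int_lattice) = {}"
      using disj that lat unfolding N disjoint_family_on_def by blast
    then show False
      using that lat unfolding N by blast
  qed
  have fin: "finite (?N m)" for m
  proof (cases "?N m = {}")
    case False
    then obtain k where "?N m = {k}"
      using uniq by blast
    then show ?thesis
      by simp
  qed (simp only: finite.emptyI)
  then show "mult_defined (gen_fun S) (gen_fun T)"
    by (simp add: mult_defined_def)
  have "(gen_fun S \<star> gen_fun T) m = gen_fun ?U m" for m
  proof (cases "?N m = {}")
    case True
    have "lattice_pt m \<notin> ?U"
    proof
      assume "lattice_pt m \<in> ?U"
      then obtain k where "lattice_pt k \<in> S" "lattice_pt m \<in> (+) (lattice_pt k) ` T"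
        by (auto simp: int_lattice_def)
      then show False
        using N[of k m] True by blast
    qed
    moreover have "gen_fun S k * gen_fun T (m - k) = 0" for k
      using True by blast
    then have "(gen_fun S \<star> gen_fun T) m = 0"
      unfolding laurent_mult_def by (simp only: Sum_any.neutral)
    ultimately show ?thesis
      by (simp add: gen_fun_def)
  next
    case False
    then obtain k where k: "?N m = {k}"
      using uniq by blast
    then have "(gen_fun S \<star> gen_fun T) m = gen_fun S k * gen_fun T (m - k)"
      unfolding laurent_mult_def by (simp add: Sum_any.expand_set)
    also have "\<dots> = 1"
      using k by (auto simp: gen_fun_def split: if_splits)
    finally have "(gen_fun S \<star> gen_fun T) m = 1" .
    moreover have "lattice_pt m \<in> ?U"
      using k N[of k m] lat by blast
    ultimately show ?thesis
      by (simp add: gen_fun_def)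
  qed
  then show "gen_fun S \<star> gen_fun T = gen_fun ?U"
    by blast
qed

text \<open>A lattice point lies in at most one of the sets, so at most one indicator
  contributes.\<close>

lemma sum_gen_fun:
  assumes "finite I" "disjoint_family_on A I"
  shows "(\<Sum>i\<in>I. gen_fun (A i)) = gen_fun (\<Union>i\<in>I. A i)"
proof
  fix m
  have "(\<Sum>i\<in>I. gen_fun (A i)) m = (\<Sum>i\<in>I. gen_fun (A i) m)"
    using assms(1) by (induction I) auto
  also have "\<dots> = gen_fun (\<Union>i\<in>I. A i) m"
  proof (cases "\<exists>j\<in>I. lattice_pt m \<in> A j")
    case True
    then obtain j where j: "j \<in> I" "lattice_pt m \<in> A j"
      by blast
    then have "lattice_pt m \<in> A i \<longleftrightarrow> i = j" if "i \<in> I" for i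
      using assms(2) that by (auto simp: disjoint_family_on_def)
    then have "(\<Sum>i\<in>I. gen_fun (A i) m) = (\<Sum>i\<in>I. if i = j then 1 else 0)"
      by (intro sum.cong) (auto simp: gen_fun_def)
    then show ?thesis
      using j assms(1) by (auto simp: gen_fun_def)
  qed (auto simp: gen_fun_def)
  finally show "(\<Sum>i\<in>I. gen_fun (A i)) m = gen_fun (\<Union>i\<in>I. A i) m" .
qed

lemma mem_cone_up:
  "(v, h) \<in> cone_up i P \<longleftrightarrow> (v, h - real i / real (dual_denominator P)) \<in> cone_over P"
  by (force simp: cone_up_def last_unit_def image_iff)

lemma mem_lenv_cone_up:
  "(v, h) \<in> lenv_cone_up i P \<longleftrightarrow>
    (v, h - real i / real (dual_denominator P)) \<in> lower_envelope (cone_over P)"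
  by (force simp: lenv_cone_up_def last_unit_def image_iff)

lemma mem_cone_down:
  "(v, h) \<in> cone_down P i K \<longleftrightarrow> (v, h + real i / real (dual_denominator P)) \<in> cone_over K"
  by (force simp: cone_down_def last_unit_def image_iff)

text \<open>Heights of lattice points over a fixed lattice point \<open>v\<close> lie in \<open>(1/d) \<int>\<close> relative to the
  lower envelope, so the half-open slab between two consecutive shifts contains only the
  lattice points of the shifted lower envelope.\<close>
lemma gen_fun_cone_up_diff:
  fixes P :: "(real ^ 'n) set"
  assumes P: "rational_polytope P" and "0 \<in> P"
  shows "gen_fun (cone_up i P) - gen_fun (cone_up (i + 1) P) = gen_fun (lenv_cone_up i P)"
proof
  fix m :: "(int ^ 'n) \<times> int"
  have poly: "polytope P"
    using P by (simp add: rational_polytope_def)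
  define d where "d = real (dual_denominator P)"
  have d: "d > 0"
    using dual_denominator(1)[OF P] by (simp add: d_def)
  obtain v h where m: "lattice_pt m = (v, h)"
    by (cases "lattice_pt m")
  then have "(v, h) \<in> int_lattice"
    by (metis int_lattice_def rangeI)
  then have int: "\<And>i. v $ i \<in> \<int>" "h \<in> \<int>"
    by (auto simp: mem_int_lattice)
  have up: "lattice_pt m \<in> cone_up j P \<longleftrightarrow> (v, h - real j / d) \<in> cone_over P" for j
    by (simp add: m mem_cone_up d_def)
  have env: "lattice_pt m \<in> lenv_cone_up i P \<longleftrightarrow> (v, h - real i / d) \<in> lower_envelope (cone_over P)"
    by (simp add: m mem_lenv_cone_up d_def)
  \<comment> \<open>The second conjunct excludes the coefficient -1 in the difference.\<close>
  have "(lattice_pt m \<in> lenv_cone_up i P \<longleftrightarrow>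
      lattice_pt m \<in> cone_up i P \<and> lattice_pt m \<notin> cone_up (i + 1) P) \<and>
    (lattice_pt m \<in> cone_up (i + 1) P \<longrightarrow> lattice_pt m \<in> cone_up i P)"
  proof (cases "\<exists>t. (v, t) \<in> cone_over P")
    case True
    then obtain r where r: "(v, r) \<in> cone_over P" "\<And>t. (v, t) \<in> cone_over P \<Longrightarrow> r \<le> t"
      using cone_over_least_height[OF poly] by blast
    have iff: "(v, t) \<in> cone_over P \<longleftrightarrow> r \<le> t" for t
      using r cone_over_mono_height[OF polytope_imp_convex[OF poly] \<open>0 \<in> P\<close>] by blast
    have env_iff: "(v, t) \<in> lower_envelope (cone_over P) \<longleftrightarrow> t = r" for t
      using mem_lower_envelope_cone_over[OF poly] iff by force
    have "d * r \<in> \<int>"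
      using lower_envelope_height_denominator[OF P _ int(1)] env_iff by (simp add: d_def)
    moreover have "d * h \<in> \<int>"
      using int(2) by (simp add: d_def)
    ultimately have "d * h - d * r - real i \<in> \<int>"
      by (intro Ints_diff) auto
    \<comment> \<open>The integer \<open>k\<close> decides everything: the point is in
      \<open>cone_up i P\<close> iff \<open>k \<ge> 0\<close>, in the next shift iff
      \<open>k \<ge> 1\<close>, and on the shifted envelope iff \<open>k = 0\<close>.\<close>
    then obtain k where k: "d * h - d * r - real i = of_int k"
      by (elim Ints_cases)
    have "h - real j / d = r \<longleftrightarrow> d * h - d * r - real j = 0"
      "r \<le> h - real j / d \<longleftrightarrow> d * h - d * r - real j \<ge> 0" for j :: nat
      using d by (auto simp: field_simps)
    moreover have "d * h - d * r - real (i + 1) = of_int (k - 1)"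
      using k by simp
    ultimately show ?thesis
      unfolding up env env_iff iff by (simp only: k of_int_0_le_iff of_int_eq_0_iff) linarith
  next
    case False
    then show ?thesis
      unfolding up env mem_lower_envelope_cone_over[OF poly] by blast
  qed
  then show "(gen_fun (cone_up i P) - gen_fun (cone_up (i + 1) P)) m = gen_fun (lenv_cone_up i P) m"
    by (auto simp: gen_fun_def)
qed

subsection \<open>Free sums\<close>

text \<open>By Cramer's rule with determinant 1, the coordinates of \<open>x\<close> are
  determinants of integer matrices.\<close>

lemma SL_int_reflects_Ints:
  assumes g: "g \<in> SL_int" and int: "\<And>i. (g *v x) $ i \<in> \<int>"
  shows "x $ i \<in> \<int>"
proof -
  have det_Ints: "det A \<in> \<int>" if "\<And>i j. A $ i $ j \<in> \<int>" for A :: "real ^ 'n ^ 'n"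
    unfolding det_def using that by (intro Ints_sum Ints_mult Ints_prod) auto
  have "x = (\<chi> k. det (\<chi> i j. if j = k then (g *v x) $ i else g $ i $ j) / det g)"
    using cramer[of g x "g *v x"] g by (simp add: SL_int_def)
  then have "x $ i = det (\<chi> i' j. if j = i then (g *v x) $ i' else g $ i' $ j)"
    using g by (subst (asm) vec_eq_iff) (simp add: SL_int_def)
  also have "\<dots> \<in> \<int>"
    using g int by (intro det_Ints) (auto simp: SL_int_def)
  finally show ?thesis .
qed

lemma SL_int_mult_eq_0_iff:
  assumes "g \<in> SL_int"
  shows "g *v x = 0 \<longleftrightarrow> x = 0"
proof -
  have "inj ((*v) g)"
    using assms by (intro inj_matrix_vector_mult) (simp add: invertible_det_nz SL_int_def)
  then have "g *v x = g *v 0 \<longleftrightarrow> x = 0"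
    by (rule inj_eq)
  then show ?thesis
    by simp
qed

lemma free_sum_contains_0:
  assumes "is_free_sum P K"
  shows "0 \<in> P" "0 \<in> K"
proof -
  obtain g where "g \<in> SL_int" "0 \<in> (*v) g ` P" "0 \<in> (*v) g ` K"
    using assms by (auto simp: is_free_sum_def)
  then show "0 \<in> P" "0 \<in> K"
    by (metis SL_int_mult_eq_0_iff imageE)+
qed

text \<open>Both claims are checked after applying \<open>g\<close>: orthogonal spans meet only in
  0, and projecting onto a coordinate subspace preserves integrality, which \<open>g\<close> then
  reflects.\<close>

lemma free_sum_spans:
  fixes P K :: "(real ^ 'n) set"
  assumes "is_free_sum P K"
  shows "span P \<inter> span K = {0}"
    and "\<And>v w i. v \<in> span P \<Longrightarrow> w \<in> span K \<Longrightarrow> (\<And>i. (v + w) $ i \<in> \<int>) \<Longrightarrow> v $ i \<in> \<int>"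
proof -
  obtain g where g: "g \<in> SL_int" "coordinate_subspace (span ((*v) g ` P))"
    and orth: "\<And>x y. x \<in> span ((*v) g ` P) \<Longrightarrow> y \<in> span ((*v) g ` K) \<Longrightarrow> orthogonal x y"
    using assms by (auto simp: is_free_sum_def)
  have span_g: "g *v x \<in> span ((*v) g ` S)" if "x \<in> span S" for x S
    using that linear_span_image[of "(*v) g" S] by auto
  obtain I where I: "span ((*v) g ` P) = span ((\<lambda>i. axis i 1) ` I)"
    using g by (auto simp: coordinate_subspace_def)
  show "span P \<inter> span K = {0}"
  proof (intro equalityI subsetI)
    fix x assume "x \<in> span P \<inter> span K"
    then have "orthogonal (g *v x) (g *v x)"
      using orth span_g by blast
    then have "g *v x = 0"
      by (simp add: orthogonal_def)
    then show "x \<in> {0}"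
      by (simp add: SL_int_mult_eq_0_iff[OF g(1)])
  qed (simp add: span_zero)
  show "v $ i \<in> \<int>" if v: "v \<in> span P" and w: "w \<in> span K" and int: "\<And>i. (v + w) $ i \<in> \<int>" for v w i
  proof (rule SL_int_reflects_Ints[OF g(1)])
    fix j
    show "(g *v v) $ j \<in> \<int>"
    \<comment> \<open>For \<open>j\<close> in \<open>I\<close> the vector \<open>g *v w\<close>
      contributes nothing to coordinate \<open>j\<close>; otherwise that coordinate of
      \<open>g *v v\<close> is zero.\<close>
    proof (cases "j \<in> I")
      case True
      then have "orthogonal (axis j 1) (g *v w)"
        using orth span_g[OF w] I by (metis imageI span_base)
      then have "(g *v w) $ j = 0"
        by (simp add: orthogonal_def inner_axis')
      then have "(g *v v) $ j = (g *v (v + w)) $ j"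
        by (simp add: matrix_vector_right_distrib)
      also have "\<dots> \<in> \<int>"
        using g(1) int by (auto simp: matrix_vector_mult_def SL_int_def intro!: Ints_sum Ints_mult)
      finally show ?thesis .
    next
      case False
      have "orthogonal (axis j 1) (g *v v)"
      proof (rule orthogonal_to_span)
        show "g *v v \<in> span ((\<lambda>i. axis i 1) ` I)"
          using span_g[OF v] I by simp
      qed (use False in \<open>auto simp: orthogonal_def inner_axis_axis\<close>)
      then show ?thesis
        by (simp add: orthogonal_def inner_axis')
    qed
  qed
qed

text \<open>The convex cone generated by a union is the Minkowski sum of the two generated
  cones.\<close>

lemma cone_over_hull_sum:
  fixes P K :: "(real ^ 'n) set"
  assumes "convex P" "convex K" "P \<noteq> {}" "K \<noteq> {}"
  shows "cone_over (hull_sum P K) = {a + b | a b. a \<in> cone_over P \<and> b \<in> cone_over K}"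
proof -
  have hull: "cone_over S = convex_cone hull ((\<lambda>a. (a, 1)) ` S)"
    if "convex S" "S \<noteq> {}" for S :: "(real ^ 'n) set"
    using cone_over_convex_hull[OF that(2)] that(1) by (simp only: hull_same)
  have "cone_over (hull_sum P K) = convex_cone hull ((\<lambda>a. (a, 1)) ` P \<union> (\<lambda>a. (a, 1)) ` K)"
    using assms(3) by (simp add: hull_sum_def cone_over_convex_hull image_Un)
  then show ?thesis
    unfolding convex_cone_hull_Un hull[OF assms(1,3)] hull[OF assms(2,4)] by blast
qed

text \<open>Trivial intersection of the spans forces equal base points. The heights then differ by
  an integer that is also a difference of two shifts below 1, hence by 0.\<close>

lemma free_sum_decomposition_unique:
  fixes P K :: "(real ^ 'n) set"
  assumes P: "rational_polytope P" and sum: "is_free_sum P K"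
    and i: "i < dual_denominator P" "i' < dual_denominator P"
    and x: "x \<in> lenv_cone_up i P \<inter> int_lattice" "x' \<in> lenv_cone_up i' P \<inter> int_lattice"
    and z: "z \<in> (+) x ` cone_down P i K" "z \<in> (+) x' ` cone_down P i' K"
  shows "i = i' \<and> x = x'"
proof -
  have poly: "polytope P"
    using P by (simp add: rational_polytope_def)
  define d where "d = real (dual_denominator P)"
  have d: "d > 0"
    using dual_denominator(1)[OF P] by (simp add: d_def)
  obtain v h v' h' where vh: "x = (v, h)" "x' = (v', h')"
    by (cases x, cases x')
  obtain w s where ws: "z = (v + w, h + s)" "(w, s) \<in> cone_down P i K"
    using z(1) by (auto simp: vh)
  obtain w' s' where ws': "z = (v' + w', h' + s')" "(w', s') \<in> cone_down P i' K"
    using z(2) by (auto simp: vh)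
  have env: "(v, h - real i / d) \<in> lower_envelope (cone_over P)"
    "(v', h' - real i' / d) \<in> lower_envelope (cone_over P)"
    using x by (auto simp: vh mem_lenv_cone_up d_def)
  then have cone: "(v, h - real i / d) \<in> cone_over P" "(v', h' - real i' / d) \<in> cone_over P"
    by (auto simp: mem_lower_envelope_cone_over[OF poly])
  have "w \<in> span K" "w' \<in> span K"
    using ws(2) ws'(2) by (auto simp: mem_cone_down dest: cone_over_in_span)
  moreover have "v \<in> span P" "v' \<in> span P"
    using cone by (auto dest: cone_over_in_span)
  moreover have "v - v' = w' - w"
    using ws(1) ws'(1) by (simp add: algebra_simps)
  ultimately have "v - v' \<in> span P \<inter> span K"
    by (metis IntI span_diff)
  then have v: "v = v'"
    by (simp add: free_sum_spans(1)[OF sum])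
  \<comment> \<open>Both sides are the least height over the same point \<open>v\<close>.\<close>
  then have "h - real i / d = h' - real i' / d"
    using env by (force simp: mem_lower_envelope_cone_over[OF poly])
  then have eq: "d * (h - h') = real i - real i'"
    using d by (simp add: field_simps)
  have "h - h' \<in> \<int>"
    using x by (auto simp: vh mem_int_lattice)
  then obtain k where k: "h - h' = of_int k"
    by (elim Ints_cases)
  have "k = 0"
  proof (rule ccontr)
    assume "k \<noteq> 0"
    then have "1 \<le> \<bar>of_int k :: real\<bar>"
      by simp
    then have "d * 1 \<le> d * \<bar>h - h'\<bar>"
      using d k by (intro mult_left_mono) auto
    also have "\<dots> = \<bar>real i - real i'\<bar>"
      using eq d by (metis abs_mult abs_of_pos)
    also have "\<dots> < d"
      using i by (simp add: d_def)
    finally show False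
      by simp
  qed
  with eq k v show ?thesis
    by (simp add: vh)
qed

text \<open>The height of a point of the sum cone is redistributed: the \<open>P\<close> part takes
  the least height raised to the next integer, and the \<open>K\<close> part takes the rest.\<close>

lemma free_sum_decomposition:
  fixes P K :: "(real ^ 'n) set"
  assumes P: "rational_polytope P" and K: "convex K" and sum: "is_free_sum P K"
  shows "cone_over (hull_sum P K) \<inter> int_lattice =
    (\<Union>i\<in>{0..<dual_denominator P}. \<Union>x\<in>lenv_cone_up i P \<inter> int_lattice.
      ((+) x ` cone_down P i K) \<inter> int_lattice)" (is "?L = ?R")
proof -
  have poly: "polytope P"
    using P by (simp add: rational_polytope_def)
  have zero: "0 \<in> P" "0 \<in> K"
    using free_sum_contains_0[OF sum] .
  define d where "d = real (dual_denominator P)"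
  have d: "d > 0"
    using dual_denominator(1)[OF P] by (simp add: d_def)
  have cone: "cone_over (hull_sum P K) = {a + b | a b. a \<in> cone_over P \<and> b \<in> cone_over K}"
    using zero K polytope_imp_convex[OF poly] by (intro cone_over_hull_sum) auto
  show ?thesis
  proof (intro equalityI subsetI)
    fix z assume z: "z \<in> ?L"
    then obtain v s w t where vw: "(v, s) \<in> cone_over P" "(w, t) \<in> cone_over K" "z = (v + w, s + t)"
      unfolding cone by force
    have int: "\<And>i. (v + w) $ i \<in> \<int>" "s + t \<in> \<int>"
      using z by (auto simp: vw(3) mem_int_lattice)
    have v_int: "\<And>i. v $ i \<in> \<int>"
      using free_sum_spans(2)[OF sum _ _ int(1)] vw(1,2) by (blast dest: cone_over_in_span)
    obtain r where r: "(v, r) \<in> cone_over P" "\<And>t. (v, t) \<in> cone_over P \<Longrightarrow> r \<le> t"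
      using cone_over_least_height[OF poly vw(1)] by blast
    then have env: "(v, r) \<in> lower_envelope (cone_over P)"
      by (simp add: mem_lower_envelope_cone_over[OF poly])
    then obtain k where k: "d * r = of_int k"
      using lower_envelope_height_denominator[OF P _ v_int] by (auto simp: d_def elim: Ints_cases)
    \<comment> \<open>\<open>k\<close> is \<open>d * r\<close>, so its negative modulo the
      denominator is the shift that makes \<open>r + real i / d\<close> an integer.\<close>
    define i where "i = nat ((- k) mod int (dual_denominator P))"
    have i: "i < dual_denominator P" "int i = (- k) mod int (dual_denominator P)"
      using dual_denominator(1)[OF P] by (simp_all add: i_def nat_less_iff)
    then have "int (dual_denominator P) dvd k + int i"
      by (metis add.commute add.right_inverse dvd_eq_mod_eq_0 mod_0 mod_add_left_eq)
    then obtain l where "k + int i = int (dual_denominator P) * l" ..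
    then have "of_int (k + int i) = d * (of_int l :: real)"
      by (simp only: d_def of_int_mult of_int_of_nat_eq)
    then have "r + real i / d = of_int l"
      using d k by (simp add: field_simps)
    then have "(v, r + real i / d) \<in> int_lattice"
      using v_int by (simp add: mem_int_lattice)
    moreover have "(v, r + real i / d) \<in> lenv_cone_up i P"
      using env by (simp add: mem_lenv_cone_up d_def)
    ultimately have x: "(v, r + real i / d) \<in> lenv_cone_up i P \<inter> int_lattice"
      by simp
    \<comment> \<open>The surplus \<open>s - r\<close> is nonnegative and can be added to the height
      over \<open>w\<close>, because \<open>K\<close> contains the origin.\<close>
    have "(w, s + t - r) \<in> cone_over K"
      using r(2)[OF vw(1)] by (intro cone_over_mono_height[OF K zero(2) vw(2)]) simp
    then have "(w, s + t - r - real i / d) \<in> cone_down P i K"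
      by (simp add: mem_cone_down d_def)
    then have "z \<in> (+) (v, r + real i / d) ` cone_down P i K"
      by (rule rev_image_eqI) (simp add: vw(3))
    with x i z show "z \<in> ?R"
      by (intro UN_I[of i] UN_I[of "(v, r + real i / d)"]) auto
  next
    fix z assume "z \<in> ?R"
    then obtain i v h w t where *: "(v, h) \<in> lenv_cone_up i P" "(w, t) \<in> cone_down P i K"
      "z = (v + w, h + t)" "z \<in> int_lattice"
      by force
    \<comment> \<open>The upward and downward shifts cancel in the sum.\<close>
    have "(v, h - real i / d) \<in> cone_over P" "(w, t + real i / d) \<in> cone_over K"
      using *(1,2) by (auto simp: mem_lenv_cone_up mem_cone_down d_def mem_lower_envelope_cone_over[OF poly])
    then have "(v, h - real i / d) + (w, t + real i / d) \<in> cone_over (hull_sum P K)"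
      unfolding cone by blast
    with *(3,4) show "z \<in> ?L"
      by simp
  qed
qed

lemma gen_fun_Int_int_lattice: "gen_fun (S \<inter> int_lattice) = gen_fun S"
  by (auto simp: gen_fun_def int_lattice_def)

theorem theorem4p2:
  fixes P K :: "(real ^ 'n) set" and d :: nat
  assumes "rational_polytope P"
    and "convex K"
    and "is_free_sum P K"
    and "d = dual_denominator P"
  shows
    "(cone_over (hull_sum P K) \<inter> int_lattice =
       (\<Union>i\<in>{0..<d}. \<Union>x\<in>lenv_cone_up i P \<inter> int_lattice.
          ((+) x ` cone_down P i K) \<inter> int_lattice))
     \<and> (\<forall>i<d. disjoint_family_on
           (\<lambda>x. ((+) x ` cone_down P i K) \<inter> int_lattice)
           (lenv_cone_up i P \<inter> int_lattice))
     \<and> (disjoint_family_on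
           (\<lambda>i. \<Union>x\<in>lenv_cone_up i P \<inter> int_lattice.
              ((+) x ` cone_down P i K) \<inter> int_lattice)
           {0..<d})
     \<and> (\<forall>i<d. mult_defined (gen_fun (lenv_cone_up i P)) (gen_fun (cone_down P i K)))
     \<and> (\<forall>i<d. mult_defined (gen_fun (cone_up i P) - gen_fun (cone_up (i + 1) P))
                            (gen_fun (cone_down P i K)))
     \<and> (gen_fun (cone_over (hull_sum P K)) =
           (\<Sum>i=0..<d. gen_fun (lenv_cone_up i P) \<star> gen_fun (cone_down P i K)))
     \<and> ((\<Sum>i=0..<d. gen_fun (lenv_cone_up i P) \<star> gen_fun (cone_down P i K)) =
           (\<Sum>i=0..<d. (gen_fun (cone_up i P) - gen_fun (cone_up (i + 1) P))
                          \<star> gen_fun (cone_down P i K)))"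
proof -
  let ?A = "\<lambda>i x. ((+) x ` cone_down P i K) \<inter> int_lattice"
  let ?B = "\<lambda>i. \<Union>x\<in>lenv_cone_up i P \<inter> int_lattice. ?A i x"
  note unique = free_sum_decomposition_unique[OF assms(1,3), folded assms(4)]
  have union: "cone_over (hull_sum P K) \<inter> int_lattice = (\<Union>i\<in>{0..<d}. ?B i)"
    using free_sum_decomposition[OF assms(1-3)] assms(4) by simp
  \<comment> \<open>Uniqueness is applied with both indices equal to \<open>i\<close>; across
    different indices it gives \<open>disj_B\<close>.\<close>
  have disj: "disjoint_family_on (?A i) (lenv_cone_up i P \<inter> int_lattice)" if "i < d" for i
    unfolding disjoint_family_on_def using unique[OF that that] by blast
  have disj_B: "disjoint_family_on ?B {0..<d}"
    unfolding disjoint_family_on_def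
  proof (intro ballI impI equals0I)
    fix i j z assume ij: "i \<in> {0..<d}" "j \<in> {0..<d}" "i \<noteq> j" and z: "z \<in> ?B i \<inter> ?B j"
    then obtain x y where "x \<in> lenv_cone_up i P \<inter> int_lattice" "z \<in> (+) x ` cone_down P i K"
      "y \<in> lenv_cone_up j P \<inter> int_lattice" "z \<in> (+) y ` cone_down P j K"
      by blast
    with ij show False
      using unique[of i j x y z] by simp
  qed
  \<comment> \<open>This makes the two sums agree term by term and transfers definedness of the
    products.\<close>
  have diff: "gen_fun (cone_up i P) - gen_fun (cone_up (i + 1) P) = gen_fun (lenv_cone_up i P)" for i
    using gen_fun_cone_up_diff[OF assms(1) free_sum_contains_0(1)[OF assms(3)]] .
  \<comment> \<open>A generating function sees only lattice points, so the set identity between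
    lattice points suffices.\<close>
  have "gen_fun (cone_over (hull_sum P K)) = gen_fun (\<Union>i\<in>{0..<d}. ?B i)"
    by (metis gen_fun_Int_int_lattice union)
  also have "\<dots> = (\<Sum>i=0..<d. gen_fun (?B i))"
    by (rule sum_gen_fun[OF _ disj_B, symmetric]) simp
  also have "\<dots> = (\<Sum>i=0..<d. gen_fun (lenv_cone_up i P) \<star> gen_fun (cone_down P i K))"
    by (intro sum.cong refl gen_fun_mult(2)[OF disj, symmetric]) simp
  finally have gen: "gen_fun (cone_over (hull_sum P K)) =
    (\<Sum>i=0..<d. gen_fun (lenv_cone_up i P) \<star> gen_fun (cone_down P i K))" .
  show ?thesis
    unfolding diff using union disj disj_B gen gen_fun_mult(1)[OF disj] by blast
qed

end
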